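(* Let $\pi\in\mathfrak M'_S$, put $V_0=\mathrm{Im}(\pi)$, let $i,j\in V_0$ be orthonormal, $k=i\times j$, let $\ell\in V_0^\perp$ be a unit vector, and set $v_0=\ell$, $v_1=i\times\ell$, $v_2=j\times\ell$, $v_3=k\times\ell$. Then for any $(a_0,a_1,a_2,a_3),(b_0,b_1,b_2,b_3)\in\mathbb R^4$ there is a unique $d\in T_\pi(\mathfrak M'_S)$ with $d(i)=\sum_{r=0}^3 a_rv_r$ and $d(j)=\sum_{r=0}^3 b_rv_r$. Consequently $\dim T_\pi(\mathfrak M'_S)=8$. Moreover, $T_\pi(\mathfrak M'_S)$ is a Lie triple subsystem of $T_\pi(\mathrm{Gr}_3(\mathbb R^7))$ (with triple product $[[d_1,d_2],d_3]$).
   Context: Let $\langle\cdot,\cdot\rangle$ be the standard inner product on $\mathbb R^7$ and $\times$ the cross product on $\mathbb R^7$ determined by $e_i\times e_{i+1}=e_{i+3}$, $e_{i+1}\times e_{i+3}=e_i$, $e_{i+3}\times e_i=e_{i+1}$ (indices mod 7, anticommutative, bilinear). Let $\Omega(x,y,z)=\langle x\times y,z\rangle$. $\mathrm{Gr}_3(\mathbb R^7)=\{\pi\in\mathrm{End}(\mathbb R^7):\pi^2=\pi,\ \pi^\sharp=\pi,\ \mathrm{tr}\,\pi=3\}$ ($\sharp$ = adjoint w.r.t. $\langle\cdot,\cdot\rangle$), and $\mathfrak M'_S=\{\pi\in\mathrm{Gr}_3(\mathbb R^7):\ \Omega(\pi x,\pi y,(1-\pi)z)=0\ \forall x,y,z\}$,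 equivalently the orthogonal projections onto $3$-dimensional subspaces $V$ with $V\times V\subseteq V$. $T_\pi(\mathrm{Gr}_3(\mathbb R^7))=\{d\in\mathrm{End}(\mathbb R^7): d\pi+\pi d=d,\ d^\sharp=d,\ \mathrm{tr}\,d=0\}$, and $T_\pi(\mathfrak M'_S)=\{d\in T_\pi(\mathrm{Gr}_3(\mathbb R^7)):\ d(x\times y)=d(x)\times y+x\times d(y)\ \forall x,y\in\mathrm{Im}(\pi)\}$. *)

theory Defs
  imports "HOL-Analysis.Analysis" "HOL-Library.Numeral_Type"
begin

text \<open>R^7 is modelled as real^7, with basis vectors e_a = axis a 1 indexed by the
  ring Z/7Z (the numeral type 7), so that index arithmetic is modulo 7.
  Endomorphisms of R^7 are 7x7 real matrices acting by matrix-vector product;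
  the adjoint w.r.t. the standard inner product is the transpose.\<close>

definition e7 :: "7 \<Rightarrow> real^7" where
  "e7 a = axis a 1"

text \<open>Cross product of basis vectors: e_i x e_(i+1) = e_(i+3), e_(i+1) x e_(i+3) = e_i,
  e_(i+3) x e_i = e_(i+1), extended by anticommutativity; all other products of basis
  vectors (in particular e_a x e_a) are zero.\<close>
definition cross_basis :: "7 \<Rightarrow> 7 \<Rightarrow> real^7" where
  "cross_basis a b =
     (if b = a + 1 then e7 (a + 3)
      else if a = b + 1 then - e7 (b + 3)
      else if b = a + 2 then e7 (a - 1)
      else if a = b + 2 then - e7 (b - 1)
      else if a = b + 3 then e7 (b + 1)
      else if b = a + 3 then - e7 (a + 1)
      else 0)"

definition cross7 :: "real^7 \<Rightarrow> real^7 \<Rightarrow> real^7" where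
  "cross7 x y = (\<Sum>a\<in>UNIV. \<Sum>b\<in>UNIV. (x$a * y$b) *\<^sub>R cross_basis a b)"

definition Omega7 :: "real^7 \<Rightarrow> real^7 \<Rightarrow> real^7 \<Rightarrow> real" where
  "Omega7 x y z = (cross7 x y) \<bullet> z"

definition Gr3 :: "(real^7^7) set" where
  "Gr3 = {p. p ** p = p \<and> transpose p = p \<and> trace p = 3}"

definition MS' :: "(real^7^7) set" where
  "MS' = {p \<in> Gr3. \<forall>x y z. Omega7 (p *v x) (p *v y) ((mat 1 - p) *v z) = 0}"

definition TGr3 :: "real^7^7 \<Rightarrow> (real^7^7) set" where
  "TGr3 p = {d. d ** p + p ** d = d \<and> transpose d = d \<and> trace d = 0}"

definition TMS' :: "real^7^7 \<Rightarrow> (real^7^7) set" where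
  "TMS' p = {d \<in> TGr3 p. \<forall>x\<in>range ((*v) p). \<forall>y\<in>range ((*v) p).
      d *v (cross7 x y) = cross7 (d *v x) y + cross7 x (d *v y)}"

definition bracket :: "real^7^7 \<Rightarrow> real^7^7 \<Rightarrow> real^7^7" where
  "bracket a b = a ** b - b ** a"

text \<open>A Lie triple subsystem of T: a linear subspace of T closed under [[d1,d2],d3].\<close>
definition lie_triple_subsystem :: "(real^7^7) set \<Rightarrow> (real^7^7) set \<Rightarrow> bool" where
  "lie_triple_subsystem S T \<longleftrightarrow> subspace S \<and> S \<subseteq> T \<and>
     (\<forall>d1\<in>S. \<forall>d2\<in>S. \<forall>d3\<in>S. bracket (bracket d1 d2) d3 \<in> S)"

end

theory Submission
  imports Defs
begin

(* Every p in M'_S is conjugate to the projection std_proj onto span {e0, e1, e3} by an orthogonal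
   matrix preserving the cross product: the frame i, j, l, i \<times> j, j \<times> l, l \<times> (i \<times> j), i \<times> l
   obeys the same multiplication table as e0, ..., e6, and since trace p = 3 while p already fixes
   i, j and i \<times> j, p is the projection onto the span of these three frame vectors. Conjugation
   transports T(M'_S), so it suffices to work at std_proj. There block structure and symmetry
   determine a tangent vector d by d e0, d e1 in the orthogonal complement of V0 and by d e3, which
   the derivation rule fixes to d e0 \<times> e1 + e0 \<times> d e1; every choice occurs, so the dimension is
   8. Finally d (2 std_proj - 1) is a derivation of the whole cross product, hence [d1, d2] is a
   derivation commuting with std_proj, and bracketing it with d3 preserves the derivation rule
   on V0. *)

section \<open>Coordinates and the cross product on R^7\<close>

lemma exhaust_7:
  fixes x :: 7
  shows "x = 0 \<or> x = 1 \<or> x = 2 \<or> x = 3 \<or> x = 4 \<or> x = 5 \<or> x = 6"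
proof (induct x)
  case (of_int z)
  then have "z = 0 \<or> z = 1 \<or> z = 2 \<or> z = 3 \<or> z = 4 \<or> z = 5 \<or> z = 6" by fastforce
  then show ?case by auto
qed

lemma forall_7: "(\<forall>c::7. P c) \<longleftrightarrow> P 0 \<and> P 1 \<and> P 2 \<and> P 3 \<and> P 4 \<and> P 5 \<and> P 6"
  by (metis exhaust_7)

lemma UNIV_7: "(UNIV::7 set) = {0, 1, 2, 3, 4, 5, 6}"
  using exhaust_7 by auto

lemma sum_7: "(\<Sum>c\<in>(UNIV::7 set). f c) = f 0 + f 1 + f 2 + f 3 + f 4 + f 5 + f 6"
  unfolding UNIV_7 by (simp add: add.assoc)

lemma numeral_7_reduce: "(7::7) = 0" "(8::7) = 1" "(9::7) = 2" "(-1::7) = 6"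
  by simp_all

lemma vec7_eq_iff: "(x::real^7) = y \<longleftrightarrow>
    x$0 = y$0 \<and> x$1 = y$1 \<and> x$2 = y$2 \<and> x$3 = y$3 \<and> x$4 = y$4 \<and> x$5 = y$5 \<and> x$6 = y$6"
  by (simp add: vec_eq_iff forall_7)

lemma inner_vec7: "(x::real^7) \<bullet> y =
    x$0*y$0 + x$1*y$1 + x$2*y$2 + x$3*y$3 + x$4*y$4 + x$5*y$5 + x$6*y$6"
  by (simp add: inner_vec_def sum_7)

lemma e7_nth [simp]: "e7 a $ b = (if b = a then 1 else 0)"
  by (simp add: e7_def axis_def)

lemma matrix_vector_mult_e7_nth: "(A *v e7 c) $ r = A $ r $ c"
  by (simp add: matrix_vector_mul_component e7_def inner_axis)

lemma matrix7_eq_columns: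
  assumes "A *v e7 0 = B *v e7 0" "A *v e7 1 = B *v e7 1" "A *v e7 2 = B *v e7 2"
    "A *v e7 3 = B *v e7 3" "A *v e7 4 = B *v e7 4" "A *v e7 5 = B *v e7 5" "A *v e7 6 = B *v e7 6"
  shows "(A::real^7^7) = B"
proof -
  have "A *v e7 c = B *v e7 c" for c
    using exhaust_7[of c] assms by blast
  then show ?thesis
    by (metis matrix_vector_mult_e7_nth vec_eq_iff)
qed

lemma cross_basis_table [simp]:
  "cross_basis 0 0 = 0" "cross_basis 0 1 = e7 3" "cross_basis 0 2 = e7 6" "cross_basis 0 3 = - e7 1"
  "cross_basis 0 4 = e7 5" "cross_basis 0 5 = - e7 4" "cross_basis 0 6 = - e7 2"
  "cross_basis 1 0 = - e7 3" "cross_basis 1 1 = 0" "cross_basis 1 2 = e7 4" "cross_basis 1 3 = e7 0"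
  "cross_basis 1 4 = - e7 2" "cross_basis 1 5 = e7 6" "cross_basis 1 6 = - e7 5"
  "cross_basis 2 0 = - e7 6" "cross_basis 2 1 = - e7 4" "cross_basis 2 2 = 0" "cross_basis 2 3 = e7 5"
  "cross_basis 2 4 = e7 1" "cross_basis 2 5 = - e7 3" "cross_basis 2 6 = e7 0"
  "cross_basis 3 0 = e7 1" "cross_basis 3 1 = - e7 0" "cross_basis 3 2 = - e7 5" "cross_basis 3 3 = 0"
  "cross_basis 3 4 = e7 6" "cross_basis 3 5 = e7 2" "cross_basis 3 6 = - e7 4"
  "cross_basis 4 0 = - e7 5" "cross_basis 4 1 = e7 2" "cross_basis 4 2 = - e7 1" "cross_basis 4 3 = - e7 6"
  "cross_basis 4 4 = 0" "cross_basis 4 5 = e7 0" "cross_basis 4 6 = e7 3"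
  "cross_basis 5 0 = e7 4" "cross_basis 5 1 = - e7 6" "cross_basis 5 2 = e7 3" "cross_basis 5 3 = - e7 2"
  "cross_basis 5 4 = - e7 0" "cross_basis 5 5 = 0" "cross_basis 5 6 = e7 1"
  "cross_basis 6 0 = e7 2" "cross_basis 6 1 = e7 5" "cross_basis 6 2 = - e7 0" "cross_basis 6 3 = e7 4"
  "cross_basis 6 4 = - e7 3" "cross_basis 6 5 = - e7 1" "cross_basis 6 6 = 0"
  by (simp_all add: cross_basis_def numeral_7_reduce)

lemma cross7_nth:
  "cross7 x y $ 0 = x$1*y$3 - x$3*y$1 + x$2*y$6 - x$6*y$2 + x$4*y$5 - x$5*y$4"
  "cross7 x y $ 1 = x$2*y$4 - x$4*y$2 + x$3*y$0 - x$0*y$3 + x$5*y$6 - x$6*y$5"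
  "cross7 x y $ 2 = x$3*y$5 - x$5*y$3 + x$4*y$1 - x$1*y$4 + x$6*y$0 - x$0*y$6"
  "cross7 x y $ 3 = x$4*y$6 - x$6*y$4 + x$5*y$2 - x$2*y$5 + x$0*y$1 - x$1*y$0"
  "cross7 x y $ 4 = x$5*y$0 - x$0*y$5 + x$6*y$3 - x$3*y$6 + x$1*y$2 - x$2*y$1"
  "cross7 x y $ 5 = x$6*y$1 - x$1*y$6 + x$0*y$4 - x$4*y$0 + x$2*y$3 - x$3*y$2"
  "cross7 x y $ 6 = x$0*y$2 - x$2*y$0 + x$1*y$5 - x$5*y$1 + x$3*y$4 - x$4*y$3"
  unfolding cross7_def sum_component vector_scaleR_component sum_7 by simp_all

lemma cross7_e7: "cross7 (e7 a) (e7 b) = cross_basis a b"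
proof -
  have "\<forall>a b. cross7 (e7 a) (e7 b) = cross_basis a b"
    unfolding forall_7 by (simp add: vec7_eq_iff cross7_nth)
  then show ?thesis by blast
qed

lemma cross7_add_left: "cross7 (x + y) z = cross7 x z + cross7 y z"
  and cross7_add_right: "cross7 z (x + y) = cross7 z x + cross7 z y"
  and cross7_diff_left: "cross7 (x - y) z = cross7 x z - cross7 y z"
  and cross7_diff_right: "cross7 z (x - y) = cross7 z x - cross7 z y"
  and cross7_minus_left: "cross7 (- x) z = - cross7 x z"
  and cross7_scaleR_left: "cross7 (c *\<^sub>R x) z = c *\<^sub>R cross7 x z"
  and cross7_scaleR_right: "cross7 z (c *\<^sub>R x) = c *\<^sub>R cross7 z x"
  by (simp_all add: vec7_eq_iff cross7_nth algebra_simps)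

lemma cross7_self [simp]: "cross7 z z = 0"
  by (simp add: vec7_eq_iff cross7_nth)

lemma cross7_anticomm: "cross7 x y = - cross7 y x"
  by (simp add: vec7_eq_iff cross7_nth)

lemma inner_cross7_left: "cross7 x y \<bullet> x = 0"
  and inner_cross7_right: "cross7 x y \<bullet> y = 0"
  by (simp_all add: inner_vec7 cross7_nth algebra_simps)

lemma cross7_inner_cycle: "cross7 x y \<bullet> z = cross7 y z \<bullet> x"
  by (simp add: inner_vec7 cross7_nth algebra_simps)

lemma inner_cross7_cross7: "cross7 a b \<bullet> cross7 a c = (a \<bullet> a) * (b \<bullet> c) - (a \<bullet> b) * (a \<bullet> c)"
  by (simp add: inner_vec7 cross7_nth algebra_simps)

lemma cross7_cross7_left: "cross7 (cross7 a b) a = (a \<bullet> a) *\<^sub>R b - (a \<bullet> b) *\<^sub>R a"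
  and cross7_cross7_right: "cross7 b (cross7 a b) = (b \<bullet> b) *\<^sub>R a - (a \<bullet> b) *\<^sub>R b"
  by (simp_all add: vec7_eq_iff inner_vec7 cross7_nth algebra_simps)

lemma cross7_cross7_cross7:
  "cross7 x (cross7 y z) =
     - cross7 (cross7 x y) z + (2 * (x \<bullet> z)) *\<^sub>R y - (y \<bullet> z) *\<^sub>R x - (x \<bullet> y) *\<^sub>R z"
  by (simp add: vec7_eq_iff inner_vec7 cross7_nth algebra_simps)

section \<open>Frames adapted to the cross product\<close>

lemma cross7_unit_line:
  assumes "a \<bullet> a = 1" "b \<bullet> b = 1" "a \<bullet> b = 0" "cross7 a b = c"
  shows "c \<bullet> c = 1" "a \<bullet> c = 0" "b \<bullet> c = 0"
    and "cross7 b c = a" "cross7 c a = b" "cross7 b a = - c" "cross7 c b = - a" "cross7 a c = - b"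
proof -
  show "c \<bullet> c = 1" using inner_cross7_cross7[of a b b] assms by simp
  show "a \<bullet> c = 0" "b \<bullet> c = 0"
    using inner_cross7_left[of a b] inner_cross7_right[of a b] assms by (simp_all add: inner_commute)
  show bc: "cross7 b c = a" using cross7_cross7_right[of b a] assms by simp
  show ca: "cross7 c a = b" using cross7_cross7_left[of a b] assms by simp
  show "cross7 b a = - c" using cross7_anticomm[of b a] assms by simp
  show "cross7 c b = - a" using cross7_anticomm[of c b] bc by simp
  show "cross7 a c = - b" using cross7_anticomm[of a c] ca by simp
qed

lemma cross7_frame_orthonormal:
  assumes ii: "i \<bullet> i = 1" and jj: "j \<bullet> j = 1" and ll: "l \<bullet> l = 1"
    and ij: "i \<bullet> j = 0" and il: "i \<bullet> l = 0" and jl: "j \<bullet> l = 0"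
    and hk: "k = cross7 i j" and kl: "k \<bullet> l = 0"
  defines "f4 \<equiv> cross7 j l" and "f5 \<equiv> cross7 l k" and "f6 \<equiv> cross7 i l"
  shows "k \<bullet> k = 1" "f4 \<bullet> f4 = 1" "f5 \<bullet> f5 = 1" "f6 \<bullet> f6 = 1" "i \<bullet> k = 0" "j \<bullet> k = 0"
    "f4 \<bullet> i = 0" "f4 \<bullet> j = 0" "f4 \<bullet> l = 0" "f4 \<bullet> k = 0"
    "f5 \<bullet> i = 0" "f5 \<bullet> j = 0" "f5 \<bullet> l = 0" "f5 \<bullet> k = 0"
    "f6 \<bullet> i = 0" "f6 \<bullet> j = 0" "f6 \<bullet> l = 0" "f6 \<bullet> k = 0"
    "f4 \<bullet> f5 = 0" "f4 \<bullet> f6 = 0" "f5 \<bullet> f6 = 0"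
proof -
  note IJ = cross7_unit_line[OF ii jj ij hk[symmetric]]
  have lk: "l \<bullet> k = 0" using kl by (simp add: inner_commute)
  note JL = cross7_unit_line[OF jj ll jl refl, folded f4_def]
  note IL = cross7_unit_line[OF ii ll il refl, folded f6_def]
  note LK = cross7_unit_line[OF ll IJ(1) lk refl, folded f5_def]
  show "k \<bullet> k = 1" "f4 \<bullet> f4 = 1" "f5 \<bullet> f5 = 1" "f6 \<bullet> f6 = 1" "i \<bullet> k = 0" "j \<bullet> k = 0"
    "f4 \<bullet> j = 0" "f4 \<bullet> l = 0" "f5 \<bullet> l = 0" "f5 \<bullet> k = 0" "f6 \<bullet> i = 0" "f6 \<bullet> l = 0"
    using IJ JL IL LK by (simp_all add: inner_commute)
  show "f4 \<bullet> i = 0"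
    using cross7_inner_cycle[of j l i] cross7_inner_cycle[of l i j] kl by (simp add: f4_def hk)
  show "f4 \<bullet> k = 0"
    using cross7_inner_cycle[of j l k] cross7_inner_cycle[of l k j] IJ by (simp add: f4_def inner_commute il)
  show "f5 \<bullet> i = 0" using cross7_inner_cycle[of l k i] IJ by (simp add: f5_def jl)
  show "f5 \<bullet> j = 0" using cross7_inner_cycle[of l k j] IJ by (simp add: f5_def il inner_commute)
  show "f6 \<bullet> j = 0"
    using cross7_inner_cycle[of i l j] cross7_inner_cycle[of l j i] cross7_anticomm[of j i] kl
    by (simp add: f6_def hk)
  show "f6 \<bullet> k = 0"
    using cross7_inner_cycle[of i l k] cross7_inner_cycle[of l k i] IJ by (simp add: f6_def jl)
  show "f4 \<bullet> f5 = 0"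
    using inner_cross7_cross7[of l j k] cross7_anticomm[of j l] IJ
    by (simp add: f4_def f5_def ll jl lk inner_commute)
  show "f4 \<bullet> f6 = 0"
    using inner_cross7_cross7[of l j i] cross7_anticomm[of j l] cross7_anticomm[of i l]
    by (simp add: f4_def f6_def ll ij jl il inner_commute)
  show "f5 \<bullet> f6 = 0"
    using inner_cross7_cross7[of l k i] cross7_anticomm[of i l] IJ
    by (simp add: f5_def f6_def ll lk il inner_commute)
qed

lemma cross7_frame_products:
  assumes ii: "i \<bullet> i = 1" and jj: "j \<bullet> j = 1" and ll: "l \<bullet> l = 1"
    and ij: "i \<bullet> j = 0" and il: "i \<bullet> l = 0" and jl: "j \<bullet> l = 0"
    and hk: "k = cross7 i j" and kl: "k \<bullet> l = 0"
  defines "f4 \<equiv> cross7 j l" and "f5 \<equiv> cross7 l k" and "f6 \<equiv> cross7 i l"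
  shows "cross7 k f4 = f6" "cross7 f4 f5 = i" "cross7 f5 f6 = j" "cross7 f6 i = l"
proof -
  note O = cross7_frame_orthonormal[OF assms(1-8), folded f4_def f5_def f6_def]
  note IJ = cross7_unit_line[OF ii jj ij hk[symmetric]]
  have lk: "l \<bullet> k = 0" using kl by (simp add: inner_commute)
  have f4l: "cross7 f4 l = - j" and f6i: "cross7 f6 i = l"
    using cross7_unit_line[OF jj ll jl refl] cross7_unit_line[OF ii ll il refl]
    by (simp_all add: f4_def f6_def)
  have lki: "cross7 f5 i = - cross7 l j"
    using cross7_cross7_cross7[of l k i] IJ by (simp add: f5_def inner_commute il kl)
  have ljl: "cross7 (cross7 l j) l = j"
    using cross7_cross7_left[of l j] by (simp add: ll jl inner_commute)
  show "cross7 f6 i = l" by (fact f6i)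
  show "cross7 k f4 = f6"
    using cross7_cross7_cross7[of k j l] IJ
    by (simp add: f4_def f6_def kl jl cross7_minus_left inner_commute)
  show "cross7 f4 f5 = i"
    using cross7_cross7_cross7[of f4 l k] IJ unfolding f5_def
    by (simp add: f4l O(10) lk O(9) cross7_minus_left)
  show "cross7 f5 f6 = j"
    using cross7_cross7_cross7[of f5 i l] unfolding f6_def
    by (simp add: lki O(11) il O(13) cross7_minus_left ljl)
qed

definition frame_matrix :: "('n \<Rightarrow> real^'m) \<Rightarrow> real^'n^'m" where
  "frame_matrix g = (\<chi> r q. g q $ r)"

lemma frame_matrix_mult_axis [simp]: "frame_matrix g *v axis q 1 = g q"
  by (simp add: frame_matrix_def matrix_vector_mul_component inner_axis vec_eq_iff)

lemma frame_matrix_mult_e7 [simp]: "frame_matrix g *v e7 q = g q"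
  by (simp add: e7_def)

lemma matrix_vector_mult_uminus_right: "(A::real^'n^'m) *v (- x) = - (A *v x)"
  using matrix_vector_mult_diff_distrib[of A 0 x] by simp

lemma orthogonal_frame_matrix:
  assumes "\<And>a b. g a \<bullet> g b = (if a = b then 1 else 0)"
  shows "orthogonal_matrix (frame_matrix (g :: 'n \<Rightarrow> real^'n))"
  unfolding orthogonal_matrix using assms
  by (simp add: vec_eq_iff matrix_matrix_mult_def transpose_def frame_matrix_def mat_def inner_vec_def)

lemma frame_matrix_cross7:
  assumes "\<And>a b. cross7 (g a) (g b) = frame_matrix g *v cross_basis a b"
  shows "frame_matrix g *v cross7 u v = cross7 (frame_matrix g *v u) (frame_matrix g *v v)"
proof -
  let ?Q = "frame_matrix g"
  have "(\<lambda>u v. ?Q *v cross7 u v) = (\<lambda>u v. cross7 (?Q *v u) (?Q *v v))"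
  proof (rule bilinear_eq_stdbasis)
    show "bilinear (\<lambda>u v. ?Q *v cross7 u v)" "bilinear (\<lambda>u v. cross7 (?Q *v u) (?Q *v v))"
      unfolding bilinear_def
      by (auto intro!: linearI simp: cross7_add_left cross7_add_right cross7_scaleR_left
          cross7_scaleR_right matrix_vector_right_distrib matrix_vector_mult_scaleR)
    fix x y :: "real^7" assume "x \<in> Basis" "y \<in> Basis"
    then obtain a b where "x = e7 a" "y = e7 b" by (auto simp: Basis_vec_def e7_def)
    then show "?Q *v cross7 x y = cross7 (?Q *v x) (?Q *v y)"
      by (simp add: cross7_e7 assms)
  qed
  then show ?thesis by metis
qed

text \<open>The seven lines of the Fano plane, through q, q + 1 and q + 3, determine the whole
  multiplication table.\<close>
lemma cross7_table_from_lines: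
  assumes orthonormal: "\<And>a b. g a \<bullet> g b = (if a = b then 1 else 0)"
    and c: "cross7 (g 0) (g 1) = g 3" "cross7 (g 1) (g 2) = g 4" "cross7 (g 2) (g 3) = g 5"
           "cross7 (g 3) (g 4) = g 6" "cross7 (g 4) (g 5) = g 0" "cross7 (g 5) (g 6) = g 1"
           "cross7 (g 6) (g 0) = g 2"
  shows "cross7 (g a) (g b) = frame_matrix g *v cross_basis a b"
proof -
  have n: "g q \<bullet> g q = 1" for q using orthonormal by simp
  have o: "g 0 \<bullet> g 1 = 0" "g 1 \<bullet> g 2 = 0" "g 2 \<bullet> g 3 = 0" "g 3 \<bullet> g 4 = 0"
    "g 4 \<bullet> g 5 = 0" "g 5 \<bullet> g 6 = 0" "g 6 \<bullet> g 0 = 0"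
    using orthonormal by simp_all
  have "\<forall>a b. cross7 (g a) (g b) = frame_matrix g *v cross_basis a b"
    unfolding forall_7
    using cross7_unit_line[OF n n o(1) c(1)] cross7_unit_line[OF n n o(2) c(2)]
      cross7_unit_line[OF n n o(3) c(3)] cross7_unit_line[OF n n o(4) c(4)]
      cross7_unit_line[OF n n o(5) c(5)] cross7_unit_line[OF n n o(6) c(6)]
      cross7_unit_line[OF n n o(7) c(7)]
    by (simp add: matrix_vector_mult_uminus_right c)
  then show ?thesis by blast
qed

definition g2_frame :: "real^7 \<Rightarrow> real^7 \<Rightarrow> real^7 \<Rightarrow> 7 \<Rightarrow> real^7" where
  "g2_frame i j l q = (if q = 0 then i else if q = 1 then j else if q = 2 then l
     else if q = 3 then cross7 i j else if q = 4 then cross7 j l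
     else if q = 5 then cross7 l (cross7 i j) else cross7 i l)"

lemma g2_frame_simps [simp]:
  "g2_frame i j l 0 = i" "g2_frame i j l 1 = j" "g2_frame i j l 2 = l"
  "g2_frame i j l 3 = cross7 i j" "g2_frame i j l 4 = cross7 j l"
  "g2_frame i j l 5 = cross7 l (cross7 i j)" "g2_frame i j l 6 = cross7 i l"
  by (simp_all add: g2_frame_def)

lemma g2_frame_orthonormal_table:
  assumes "i \<bullet> i = 1" "j \<bullet> j = 1" "l \<bullet> l = 1" "i \<bullet> j = 0" "i \<bullet> l = 0" "j \<bullet> l = 0"
    and "cross7 i j \<bullet> l = 0"
  shows "g2_frame i j l a \<bullet> g2_frame i j l b = (if a = b then 1 else 0)"
    and "cross7 (g2_frame i j l a) (g2_frame i j l b) = frame_matrix (g2_frame i j l) *v cross_basis a b"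
proof -
  note F = cross7_frame_orthonormal[OF assms(1-6) refl assms(7)]
    cross7_frame_products[OF assms(1-6) refl assms(7)]
  have O: "\<forall>a b. g2_frame i j l a \<bullet> g2_frame i j l b = (if a = b then 1 else 0)"
    unfolding forall_7 using F assms by (simp add: inner_commute)
  then show "g2_frame i j l a \<bullet> g2_frame i j l b = (if a = b then 1 else 0)" by blast
  show "cross7 (g2_frame i j l a) (g2_frame i j l b) = frame_matrix (g2_frame i j l) *v cross_basis a b"
    by (rule cross7_table_from_lines) (use O in blast, simp_all add: F)
qed

section \<open>Conjugation by orthogonal matrices\<close>

declare transpose_matrix_vector [simp del]

definition matrix_conj :: "real^'n^'n \<Rightarrow> real^'n^'n \<Rightarrow> real^'n^'n" where
  "matrix_conj Q A = Q ** A ** transpose Q"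

lemma matrix_conj_mult_vec: "matrix_conj Q A *v x = Q *v (A *v (transpose Q *v x))"
  by (simp add: matrix_conj_def matrix_vector_mul_assoc matrix_mul_assoc)

lemma matrix_conj_add: "matrix_conj Q (A + B) = matrix_conj Q A + matrix_conj Q B"
  by (subst matrix_eq) (simp add: matrix_conj_mult_vec algebra_simps)

lemma matrix_conj_diff: "matrix_conj Q (A - B) = matrix_conj Q A - matrix_conj Q B"
  by (subst matrix_eq) (simp add: matrix_conj_mult_vec algebra_simps)

lemma matrix_conj_scaleR: "matrix_conj Q (c *\<^sub>R A) = c *\<^sub>R matrix_conj Q A"
  by (subst matrix_eq) (simp add: matrix_conj_mult_vec matrix_vector_mult_scaleR
      scaleR_matrix_vector_assoc[symmetric] matrix_scaleR_vector_ac[symmetric])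

lemma linear_matrix_conj: "linear (matrix_conj Q)"
  by (rule linearI) (simp_all add: matrix_conj_add matrix_conj_scaleR)

lemma transpose_matrix_conj: "transpose (matrix_conj Q A) = matrix_conj Q (transpose A)"
  by (simp add: matrix_conj_def matrix_transpose_mul matrix_mul_assoc)

lemma transpose_diff: "transpose ((A::'a::ring_1^'n^'m) - B) = transpose A - transpose B"
  by (simp add: transpose_def vec_eq_iff)

locale orthogonal_conj =
  fixes Q :: "real^'n^'n"
  assumes orthogonal: "orthogonal_matrix Q"
begin

lemma transpose_mult_cancel [simp]: "transpose Q *v (Q *v w) = w"
  and mult_transpose_cancel [simp]: "Q *v (transpose Q *v w) = w"
  using orthogonal by (simp_all add: orthogonal_matrix_def matrix_vector_mul_assoc)

lemma matrix_conj_inverse [simp]: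
  "matrix_conj (transpose Q) (matrix_conj Q A) = A" "matrix_conj Q (matrix_conj (transpose Q) A) = A"
  by (subst matrix_eq, simp add: matrix_conj_mult_vec)+

lemma matrix_conj_eq_iff: "matrix_conj Q A = matrix_conj Q B \<longleftrightarrow> A = B"
  by (metis matrix_conj_inverse(1))

lemma matrix_conj_mult: "matrix_conj Q (A ** B) = matrix_conj Q A ** matrix_conj Q B"
  by (subst matrix_eq) (simp add: matrix_conj_mult_vec matrix_vector_mul_assoc[symmetric])

lemma trace_matrix_conj: "trace (matrix_conj Q A) = trace A"
proof -
  have "trace (matrix_conj Q A) = trace (Q ** (A ** transpose Q))"
    by (simp add: matrix_conj_def matrix_mul_assoc)
  also have "\<dots> = trace ((A ** transpose Q) ** Q)"
    by (rule trace_mul_sym)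
  also have "\<dots> = trace A"
    using orthogonal by (simp add: orthogonal_matrix_def flip: matrix_mul_assoc)
  finally show ?thesis .
qed

lemma range_matrix_conj: "range ((*v) (matrix_conj Q P)) = (*v) Q ` range ((*v) P)"
  by (auto simp: matrix_conj_mult_vec image_iff) (metis transpose_mult_cancel)

end

locale cross7_automorphism = orthogonal_conj Q for Q :: "real^7^7" +
  assumes mult_cross7: "Q *v cross7 u v = cross7 (Q *v u) (Q *v v)"
begin

lemma matrix_conj_bracket: "matrix_conj Q (bracket A B) = bracket (matrix_conj Q A) (matrix_conj Q B)"
  by (simp add: bracket_def matrix_conj_diff matrix_conj_mult)

lemma TGr3_matrix_conj_iff: "matrix_conj Q e \<in> TGr3 (matrix_conj Q P) \<longleftrightarrow> e \<in> TGr3 P"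
proof -
  have "matrix_conj Q e ** matrix_conj Q P + matrix_conj Q P ** matrix_conj Q e = matrix_conj Q e
      \<longleftrightarrow> e ** P + P ** e = e"
    by (simp only: matrix_conj_mult[symmetric] matrix_conj_add[symmetric] matrix_conj_eq_iff)
  then show ?thesis
    by (simp add: TGr3_def trace_matrix_conj transpose_matrix_conj matrix_conj_eq_iff)
qed

lemma TMS'_matrix_conj_iff: "matrix_conj Q e \<in> TMS' (matrix_conj Q P) \<longleftrightarrow> e \<in> TMS' P"
proof -
  have "matrix_conj Q e *v cross7 (Q *v x) (Q *v y) =
          cross7 (matrix_conj Q e *v (Q *v x)) (Q *v y) + cross7 (Q *v x) (matrix_conj Q e *v (Q *v y))
      \<longleftrightarrow> e *v cross7 x y = cross7 (e *v x) y + cross7 x (e *v y)" for x y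
  proof -
    have "matrix_conj Q e *v cross7 (Q *v x) (Q *v y) = Q *v (e *v cross7 x y)"
      by (simp add: matrix_conj_mult_vec flip: mult_cross7)
    moreover have "cross7 (matrix_conj Q e *v (Q *v x)) (Q *v y) + cross7 (Q *v x) (matrix_conj Q e *v (Q *v y))
        = Q *v (cross7 (e *v x) y + cross7 x (e *v y))"
      by (simp add: matrix_conj_mult_vec mult_cross7 matrix_vector_right_distrib)
    ultimately show ?thesis
      by (metis transpose_mult_cancel)
  qed
  then show ?thesis
    by (simp add: TMS'_def TGr3_matrix_conj_iff range_matrix_conj)
qed

lemma TMS'_matrix_conj: "TMS' (matrix_conj Q P) = matrix_conj Q ` TMS' P"
proof (intro equalityI subsetI)
  fix d assume "d \<in> TMS' (matrix_conj Q P)"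
  then have "matrix_conj (transpose Q) d \<in> TMS' P"
    by (simp add: TMS'_matrix_conj_iff flip: TMS'_matrix_conj_iff[of "matrix_conj (transpose Q) d"])
  then show "d \<in> matrix_conj Q ` TMS' P"
    by (metis image_eqI matrix_conj_inverse(2))
qed (auto simp: TMS'_matrix_conj_iff)

end

section \<open>Tangent vectors and derivations\<close>

lemma bracket_mult_vec: "bracket A B *v z = A *v (B *v z) - B *v (A *v z)"
  by (simp add: bracket_def matrix_vector_mult_diff_rdistrib matrix_vector_mul_assoc)

lemma TGr3_mult_proj:
  assumes "d \<in> TGr3 p"
  shows "d *v (p *v z) = d *v z - p *v (d *v z)"
proof -
  have "(d ** p + p ** d) *v z = d *v z"
    using assms by (simp add: TGr3_def)
  then show ?thesis
    by (simp add: matrix_vector_mult_add_rdistrib matrix_vector_mul_assoc algebra_simps)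
qed

lemma bracket_TGr3_commute:
  assumes "d1 \<in> TGr3 p" "d2 \<in> TGr3 p"
  shows "bracket d1 d2 *v (p *v z) = p *v (bracket d1 d2 *v z)"
  by (simp add: bracket_mult_vec TGr3_mult_proj[OF assms(1)] TGr3_mult_proj[OF assms(2)]
      matrix_vector_mult_diff_distrib)

lemma TGr3_triple_bracket:
  assumes d1: "d1 \<in> TGr3 p" and d2: "d2 \<in> TGr3 p" and d3: "d3 \<in> TGr3 p"
  shows "bracket (bracket d1 d2) d3 \<in> TGr3 p"
proof -
  let ?X = "bracket d1 d2"
  have sym: "transpose d1 = d1" "transpose d2 = d2" "transpose d3 = d3"
    using d1 d2 d3 by (simp_all add: TGr3_def)
  have "bracket ?X d3 ** p + p ** bracket ?X d3 = bracket ?X d3"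
    by (subst matrix_eq) (simp add: bracket_mult_vec[of ?X d3] matrix_vector_mult_add_rdistrib
        matrix_vector_mult_diff_distrib TGr3_mult_proj[OF d3] bracket_TGr3_commute[OF d1 d2] flip: matrix_vector_mul_assoc)
  moreover have "transpose (bracket ?X d3) = bracket ?X d3"
    by (subst matrix_eq) (simp add: bracket_def transpose_diff matrix_transpose_mul sym
        matrix_vector_mult_diff_rdistrib matrix_vector_mult_diff_distrib flip: matrix_vector_mul_assoc)
  moreover have "trace (bracket ?X d3) = 0"
    using trace_mul_sym[of ?X d3] by (simp add: bracket_def trace_sub)
  ultimately show ?thesis
    by (simp add: TGr3_def)
qed

definition cross7_derivation :: "real^7^7 \<Rightarrow> bool" where
  "cross7_derivation D \<longleftrightarrow> (\<forall>u v. D *v cross7 u v = cross7 (D *v u) v + cross7 u (D *v v))"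

lemma cross7_derivation_bracket:
  "cross7_derivation A \<Longrightarrow> cross7_derivation B \<Longrightarrow> cross7_derivation (bracket A B)"
  by (simp add: cross7_derivation_def bracket_mult_vec matrix_vector_right_distrib
      cross7_diff_left cross7_diff_right cross7_add_left cross7_add_right algebra_simps)

lemma bracket_derivation_rule:
  assumes X_der: "cross7_derivation X"
    and X_proj: "\<And>z. X *v (p *v z) = p *v (X *v z)"
    and d_der: "\<And>x y. x \<in> range ((*v) p) \<Longrightarrow> y \<in> range ((*v) p) \<Longrightarrow>
                  d *v cross7 x y = cross7 (d *v x) y + cross7 x (d *v y)"
    and x: "x \<in> range ((*v) p)" and y: "y \<in> range ((*v) p)"
  shows "bracket X d *v cross7 x y = cross7 (bracket X d *v x) y + cross7 x (bracket X d *v y)"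
proof -
  have Xx: "X *v x \<in> range ((*v) p)" and Xy: "X *v y \<in> range ((*v) p)"
    using x y X_proj by auto
  show ?thesis
    using X_der
    by (simp add: cross7_derivation_def bracket_mult_vec d_der[OF x y] d_der[OF Xx y] d_der[OF x Xy]
        matrix_vector_right_distrib cross7_diff_left cross7_diff_right algebra_simps)
qed

section \<open>The standard associative subspace\<close>

definition std_proj :: "real^7^7" where
  "std_proj = (\<chi> r c. if r = c \<and> (r = 0 \<or> r = 1 \<or> r = 3) then 1 else 0)"

lemma std_proj_nth:
  "(std_proj *v x)$0 = x$0" "(std_proj *v x)$1 = x$1" "(std_proj *v x)$2 = 0" "(std_proj *v x)$3 = x$3"
  "(std_proj *v x)$4 = 0" "(std_proj *v x)$5 = 0" "(std_proj *v x)$6 = 0"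
  by (simp_all add: std_proj_def matrix_vector_mult_def sum_7)

lemma std_proj_e7:
  "std_proj *v e7 0 = e7 0" "std_proj *v e7 1 = e7 1" "std_proj *v e7 3 = e7 3"
  "std_proj *v e7 2 = 0" "std_proj *v e7 4 = 0" "std_proj *v e7 5 = 0" "std_proj *v e7 6 = 0"
  by (simp_all add: vec7_eq_iff std_proj_nth)

text \<open>Under the frame g2_frame i j l the vectors e2, e6, e4, -e5 become l, i \<times> l, j \<times> l, k \<times> l.\<close>
definition std_normal :: "real^4 \<Rightarrow> real^7" where
  "std_normal a = a$0 *\<^sub>R e7 2 + a$1 *\<^sub>R e7 6 + a$2 *\<^sub>R e7 4 - a$3 *\<^sub>R e7 5"

definition std_normal_coords :: "real^7 \<Rightarrow> real^4" where
  "std_normal_coords v = (\<chi> q. if q = 0 then v$2 else if q = 1 then v$6 else if q = 2 then v$4 else - v$5)"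

lemma std_normal_coords_inverse: "std_normal_coords (std_normal a) = a"
proof -
  have four: "(4::4) = 0" by simp
  show ?thesis
    by (simp add: vec_eq_iff forall_4 four std_normal_coords_def std_normal_def)
qed

text \<open>The symmetric map exchanging span {e0, e1, e3} with its orthogonal complement that sends
  e0, e1 to u, w and, as the derivation rule forces, e3 = e0 \<times> e1 to u \<times> e1 + e0 \<times> w.\<close>
definition std_tangent :: "real^4 \<Rightarrow> real^4 \<Rightarrow> real^7^7" where
  "std_tangent a b = (let u = std_normal a; w = std_normal b; t = cross7 u (e7 1) + cross7 (e7 0) w in
     \<chi> r c. u$r * e7 0$c + e7 0$r * u$c + w$r * e7 1$c + e7 1$r * w$c + t$r * e7 3$c + e7 3$r * t$c)"

lemma std_tangent_nth:
  "(std_tangent a b *v x)$0 = a$0*x$2 + a$2*x$4 - a$3*x$5 + a$1*x$6"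
  "(std_tangent a b *v x)$1 = b$0*x$2 + b$2*x$4 - b$3*x$5 + b$1*x$6"
  "(std_tangent a b *v x)$2 = a$0*x$0 + b$0*x$1 + (a$2 - b$1)*x$3"
  "(std_tangent a b *v x)$3 = (a$2-b$1)*x$2 + (b$3 - a$0)*x$4 + (a$1+b$2)*x$5 + (a$3+b$0)*x$6"
  "(std_tangent a b *v x)$4 = a$2*x$0 + b$2*x$1 + (b$3 - a$0)*x$3"
  "(std_tangent a b *v x)$5 = - a$3*x$0 - b$3*x$1 + (a$1+b$2)*x$3"
  "(std_tangent a b *v x)$6 = a$1*x$0 + b$1*x$1 + (a$3+b$0)*x$3"
  by (simp_all add: std_tangent_def Let_def matrix_vector_mult_def sum_7 std_normal_def cross7_nth
      algebra_simps)

lemma transpose_std_tangent: "transpose (std_tangent a b) = std_tangent a b"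
  by (simp add: std_tangent_def Let_def transpose_def vec_eq_iff algebra_simps)

lemma std_tangent_e7: "std_tangent a b *v e7 0 = std_normal a" "std_tangent a b *v e7 1 = std_normal b"
  by (simp_all add: vec7_eq_iff std_tangent_nth std_normal_def)

lemma linear_std_tangent: "linear (\<lambda>(a, b). std_tangent a b)"
proof (rule linearI)
  show "(\<lambda>(a, b). std_tangent a b) (x + y) =
      (\<lambda>(a, b). std_tangent a b) x + (\<lambda>(a, b). std_tangent a b) y"
    for x y :: "(real^4) \<times> (real^4)"
    by (cases x, cases y) (simp add: matrix7_eq_columns vec7_eq_iff std_tangent_nth
        matrix_vector_mult_add_rdistrib)
  show "(\<lambda>(a, b). std_tangent a b) (c *\<^sub>R x) = c *\<^sub>R (\<lambda>(a, b). std_tangent a b) x"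
    for c and x :: "(real^4) \<times> (real^4)"
    by (cases x) (simp add: matrix7_eq_columns vec7_eq_iff std_tangent_nth algebra_simps
        flip: scaleR_matrix_vector_assoc)
qed

lemma inj_std_tangent: "inj (\<lambda>(a, b). std_tangent a b)"
proof (rule injI, clarsimp)
  fix a b a' b' assume "std_tangent a b = std_tangent a' b'"
  then have "std_normal a = std_normal a'" "std_normal b = std_normal b'"
    by (metis std_tangent_e7)+
  then show "a = a' \<and> b = b'"
    by (metis std_normal_coords_inverse)
qed

lemma std_tangent_TMS': "std_tangent a b \<in> TMS' std_proj"
proof -
  have "std_tangent a b ** std_proj + std_proj ** std_tangent a b = std_tangent a b"
    by (rule matrix7_eq_columns) (simp_all add: matrix_vector_mult_add_rdistrib vec7_eq_iff
        std_tangent_nth std_proj_nth flip: matrix_vector_mul_assoc)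
  moreover have "trace (std_tangent a b) = 0"
    by (simp add: trace_def sum_7 std_tangent_nth flip: matrix_vector_mult_e7_nth)
  moreover have "std_tangent a b *v cross7 (std_proj *v x) (std_proj *v y) =
      cross7 (std_tangent a b *v (std_proj *v x)) (std_proj *v y) +
      cross7 (std_proj *v x) (std_tangent a b *v (std_proj *v y))" for x y
    by (simp add: vec7_eq_iff std_tangent_nth std_proj_nth cross7_nth algebra_simps)
  ultimately show ?thesis
    by (auto simp: TMS'_def TGr3_def transpose_std_tangent)
qed

lemma TMS'_std_proj_eq_std_tangent:
  assumes "d \<in> TMS' std_proj"
  shows "d = std_tangent (std_normal_coords (d *v e7 0)) (std_normal_coords (d *v e7 1))"
proof -
  have TGr: "d \<in> TGr3 std_proj" and sym: "transpose d = d"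
    and der: "\<And>x y. x \<in> range ((*v) std_proj) \<Longrightarrow> y \<in> range ((*v) std_proj) \<Longrightarrow>
        d *v (cross7 x y) = cross7 (d *v x) y + cross7 x (d *v y)"
    using assms by (auto simp: TMS'_def TGr3_def)
  note blk = TGr3_mult_proj[OF TGr]
  have Z: "d$0$0 = 0" "d$0$1 = 0" "d$0$3 = 0" "d$1$0 = 0" "d$1$1 = 0" "d$1$3 = 0" "d$3$0 = 0"
    "d$3$1 = 0" "d$3$3 = 0" "d$2$2 = 0" "d$2$4 = 0" "d$2$5 = 0" "d$2$6 = 0" "d$4$2 = 0" "d$4$4 = 0"
    "d$4$5 = 0" "d$4$6 = 0" "d$5$2 = 0" "d$5$4 = 0" "d$5$5 = 0" "d$5$6 = 0" "d$6$2 = 0" "d$6$4 = 0"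
    "d$6$5 = 0" "d$6$6 = 0"
    using blk[of "e7 0"] blk[of "e7 1"] blk[of "e7 3"] blk[of "e7 2"] blk[of "e7 4"] blk[of "e7 5"]
      blk[of "e7 6"]
    by (simp_all add: std_proj_e7 vec7_eq_iff std_proj_nth matrix_vector_mult_e7_nth)
  have S: "d$0$c = d$c$0" "d$1$c = d$c$1" "d$3$c = d$c$3" for c
    using arg_cong[OF sym, of "\<lambda>M. M$_$c"] by (simp_all add: transpose_def)
  have e0: "e7 0 \<in> range ((*v) std_proj)" and e1: "e7 1 \<in> range ((*v) std_proj)"
    by (metis rangeI std_proj_e7(1), metis rangeI std_proj_e7(2))
  have d3: "d *v e7 3 = cross7 (d *v e7 0) (e7 1) + cross7 (e7 0) (d *v e7 1)"
    using der[OF e0 e1] by (simp add: cross7_e7)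
  show ?thesis
    by (rule matrix7_eq_columns)
      (simp_all add: vec7_eq_iff matrix_vector_mult_e7_nth[of d] Z S[of 2] S[of 4] S[of 5] S[of 6]
        d3[unfolded vec7_eq_iff matrix_vector_mult_e7_nth] cross7_nth std_tangent_nth std_normal_coords_def)
qed

lemma TMS'_std_proj: "TMS' std_proj = range (\<lambda>(a, b). std_tangent a b)"
proof (intro equalityI subsetI)
  fix d assume "d \<in> TMS' std_proj"
  then show "d \<in> range (\<lambda>(a, b). std_tangent a b)"
    using TMS'_std_proj_eq_std_tangent by (metis case_prod_conv rangeI)
qed (auto simp: std_tangent_TMS')

definition std_reflection :: "real^7^7" where
  "std_reflection = 2 *\<^sub>R std_proj - mat 1"

lemma std_reflection_mult_vec: "std_reflection *v x = 2 *\<^sub>R (std_proj *v x) - x"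
  by (simp add: std_reflection_def matrix_vector_mult_diff_rdistrib scaleR_matrix_vector_assoc)

lemma std_reflection_involutive: "std_reflection *v (std_reflection *v x) = x"
  by (simp add: std_reflection_mult_vec vec7_eq_iff std_proj_nth)

lemma std_tangent_reflection_anticomm:
  "std_tangent a b *v (std_reflection *v x) = - (std_reflection *v (std_tangent a b *v x))"
  by (simp add: std_reflection_mult_vec vec7_eq_iff std_tangent_nth std_proj_nth algebra_simps)

text \<open>The key computation: although std_tangent a b only obeys the derivation rule on
  span {e0, e1, e3}, composing it with the reflection in that subspace gives a derivation of
  the whole cross product.\<close>
lemma cross7_derivation_std_tangent_reflection:
  "cross7_derivation (std_tangent a b ** std_reflection)"
  by (simp add: cross7_derivation_def std_reflection_mult_vec vec7_eq_iff std_tangent_nth std_proj_nth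
      cross7_nth algebra_simps flip: matrix_vector_mul_assoc)

lemma cross7_derivation_bracket_std_tangent:
  "cross7_derivation (bracket (std_tangent a1 b1) (std_tangent a2 b2))"
proof -
  let ?R = std_reflection
  have "bracket (std_tangent a1 b1) (std_tangent a2 b2) =
      bracket (std_tangent a2 b2 ** ?R) (std_tangent a1 b1 ** ?R)"
    by (subst matrix_eq) (simp add: bracket_mult_vec std_tangent_reflection_anticomm
        std_reflection_involutive matrix_vector_mult_uminus_right flip: matrix_vector_mul_assoc)
  then show ?thesis
    by (simp add: cross7_derivation_bracket cross7_derivation_std_tangent_reflection)
qed

lemma TMS'_std_proj_triple_bracket:
  assumes d1: "d1 \<in> TMS' std_proj" and d2: "d2 \<in> TMS' std_proj" and d3: "d3 \<in> TMS' std_proj"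
  shows "bracket (bracket d1 d2) d3 \<in> TMS' std_proj"
proof -
  have TGr: "d1 \<in> TGr3 std_proj" "d2 \<in> TGr3 std_proj" "d3 \<in> TGr3 std_proj"
    using d1 d2 d3 by (simp_all add: TMS'_def)
  have X_der: "cross7_derivation (bracket d1 d2)"
    using TMS'_std_proj_eq_std_tangent[OF d1] TMS'_std_proj_eq_std_tangent[OF d2]
    by (metis cross7_derivation_bracket_std_tangent)
  have d3_der: "\<And>x y. x \<in> range ((*v) std_proj) \<Longrightarrow> y \<in> range ((*v) std_proj) \<Longrightarrow>
      d3 *v cross7 x y = cross7 (d3 *v x) y + cross7 x (d3 *v y)"
    using d3 unfolding TMS'_def by blast
  have "\<forall>x\<in>range ((*v) std_proj). \<forall>y\<in>range ((*v) std_proj).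
      bracket (bracket d1 d2) d3 *v cross7 x y =
        cross7 (bracket (bracket d1 d2) d3 *v x) y + cross7 x (bracket (bracket d1 d2) d3 *v y)"
    by (intro ballI bracket_derivation_rule[OF X_der bracket_TGr3_commute[OF TGr(1,2)] d3_der])
  then show ?thesis
    unfolding TMS'_def using TGr3_triple_bracket[OF TGr] by blast
qed

context cross7_automorphism
begin

lemma TMS'_conj_std_proj:
  "TMS' (matrix_conj Q std_proj) = (matrix_conj Q \<circ> (\<lambda>(a, b). std_tangent a b)) ` UNIV"
  by (simp add: TMS'_matrix_conj TMS'_std_proj image_comp)

lemma subspace_TMS'_conj_std_proj: "subspace (TMS' (matrix_conj Q std_proj))"
  unfolding TMS'_conj_std_proj
  by (intro linear_subspace_image linear_compose linear_std_tangent linear_matrix_conj subspace_UNIV)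

lemma dim_TMS'_conj_std_proj: "dim (TMS' (matrix_conj Q std_proj)) = 8"
proof -
  have "inj (matrix_conj Q \<circ> (\<lambda>(a, b). std_tangent a b))"
    using inj_std_tangent by (simp add: inj_def matrix_conj_eq_iff)
  then have "dim (TMS' (matrix_conj Q std_proj)) = dim (UNIV :: ((real^4) \<times> (real^4)) set)"
    unfolding TMS'_conj_std_proj
    by (intro eucl.dim_image_eq linear_compose linear_std_tangent linear_matrix_conj)
      (simp add: inj_on_def inj_def)
  then show ?thesis by simp
qed

lemma lie_triple_subsystem_TMS'_conj_std_proj:
  "lie_triple_subsystem (TMS' (matrix_conj Q std_proj)) (TGr3 (matrix_conj Q std_proj))"
  unfolding lie_triple_subsystem_def
proof (intro conjI ballI subspace_TMS'_conj_std_proj)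
  show "TMS' (matrix_conj Q std_proj) \<subseteq> TGr3 (matrix_conj Q std_proj)"
    by (auto simp: TMS'_def)
  fix d1 d2 d3 assume "d1 \<in> TMS' (matrix_conj Q std_proj)" "d2 \<in> TMS' (matrix_conj Q std_proj)"
    "d3 \<in> TMS' (matrix_conj Q std_proj)"
  then show "bracket (bracket d1 d2) d3 \<in> TMS' (matrix_conj Q std_proj)"
    by (auto simp: TMS'_matrix_conj simp flip: matrix_conj_bracket intro!: TMS'_std_proj_triple_bracket)
qed

lemma ex1_TMS'_conj_std_proj:
  "\<exists>!d. d \<in> TMS' (matrix_conj Q std_proj) \<and>
     d *v (Q *v e7 0) = Q *v std_normal a \<and> d *v (Q *v e7 1) = Q *v std_normal b"
proof (rule ex1I)
  show "matrix_conj Q (std_tangent a b) \<in> TMS' (matrix_conj Q std_proj) \<and>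
     matrix_conj Q (std_tangent a b) *v (Q *v e7 0) = Q *v std_normal a \<and>
     matrix_conj Q (std_tangent a b) *v (Q *v e7 1) = Q *v std_normal b"
    by (simp add: TMS'_matrix_conj_iff std_tangent_TMS' matrix_conj_mult_vec std_tangent_e7)
  fix d assume d: "d \<in> TMS' (matrix_conj Q std_proj) \<and>
     d *v (Q *v e7 0) = Q *v std_normal a \<and> d *v (Q *v e7 1) = Q *v std_normal b"
  then obtain e where e: "e \<in> TMS' std_proj" and de: "d = matrix_conj Q e"
    by (auto simp: TMS'_matrix_conj)
  have "e *v e7 0 = std_normal a" "e *v e7 1 = std_normal b"
    using d by (metis de matrix_conj_mult_vec transpose_mult_cancel)+
  then show "d = matrix_conj Q (std_tangent a b)"
    using TMS'_std_proj_eq_std_tangent[OF e] by (simp add: de std_normal_coords_inverse)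
qed

end

section \<open>Reduction of an arbitrary point of M'_S\<close>

lemma Gr3_idem: "p \<in> Gr3 \<Longrightarrow> p *v (p *v x) = p *v x"
  by (simp add: Gr3_def matrix_vector_mul_assoc)

lemma Gr3_self_adjoint:
  assumes "p \<in> Gr3"
  shows "(p *v x) \<bullet> y = x \<bullet> (p *v y)"
proof -
  have "p *v x = x v* p"
    using assms transpose_matrix_vector[of p x] by (simp add: Gr3_def)
  then show ?thesis by (simp add: dot_lmul_matrix)
qed

lemma Gr3_inner_proj: "p \<in> Gr3 \<Longrightarrow> x \<bullet> (p *v x) = (p *v x) \<bullet> (p *v x)"
  by (simp add: Gr3_self_adjoint Gr3_idem)

lemma MS'_cross7_closed:
  assumes p: "p \<in> MS'" and x: "x \<in> range ((*v) p)" and y: "y \<in> range ((*v) p)"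
  shows "p *v cross7 x y = cross7 x y"
proof -
  have G: "p \<in> Gr3" using p by (simp add: MS'_def)
  define w where "w = cross7 x y"
  have "w \<bullet> (z - p *v z) = 0" for z
    using p x y by (auto simp: MS'_def Omega7_def w_def matrix_vector_mult_diff_rdistrib)
  then have "(w - p *v w) \<bullet> (w - p *v w) = 0"
    using Gr3_inner_proj[OF G, of w] Gr3_self_adjoint[OF G, of w w]
    by (simp add: inner_diff_left inner_diff_right inner_commute)
  then show ?thesis by (simp add: w_def)
qed

lemma trace_eq_sum_frame:
  assumes "orthogonal_matrix (frame_matrix g)"
  shows "trace A = (\<Sum>q\<in>UNIV. g q \<bullet> (A *v g q))"
proof -
  let ?F = "frame_matrix g"
  have "trace A = trace ((A ** ?F) ** transpose ?F)"
    using assms by (simp add: orthogonal_matrix_def flip: matrix_mul_assoc)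
  also have "\<dots> = trace (transpose ?F ** (A ** ?F))"
    by (rule trace_mul_sym)
  also have "\<dots> = (\<Sum>q\<in>UNIV. g q \<bullet> (A *v g q))"
    by (simp add: trace_def matrix_matrix_mult_def transpose_def frame_matrix_def inner_vec_def
        matrix_vector_mult_def)
  finally show ?thesis .
qed

text \<open>The trace argument: a rank-3 orthogonal projection fixing three vectors of an orthonormal
  frame annihilates the other four.\<close>
lemma Gr3_mult_frame_matrix:
  assumes p: "p \<in> Gr3" and g: "\<And>a b. g a \<bullet> g b = (if a = b then 1 else 0)"
    and fixed: "p *v g 0 = g 0" "p *v g 1 = g 1" "p *v g 3 = g 3"
  shows "p ** frame_matrix g = frame_matrix g ** std_proj"
proof -
  have "(\<Sum>q\<in>UNIV. g q \<bullet> (p *v g q)) = 3"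
    using trace_eq_sum_frame[OF orthogonal_frame_matrix[OF g], of p] p by (simp add: Gr3_def)
  then have "g 2 \<bullet> (p *v g 2) + g 4 \<bullet> (p *v g 4) + g 5 \<bullet> (p *v g 5) + g 6 \<bullet> (p *v g 6) = 0"
    using fixed g by (simp add: sum_7)
  moreover have "0 \<le> g q \<bullet> (p *v g q)" for q
    by (simp add: Gr3_inner_proj[OF p])
  ultimately have "g q \<bullet> (p *v g q) = 0" if "q \<in> {2, 4, 5, 6}" for q
    using that by (smt (verit) empty_iff insert_iff)
  then have "p *v g 2 = 0" "p *v g 4 = 0" "p *v g 5 = 0" "p *v g 6 = 0"
    by (simp_all add: Gr3_inner_proj[OF p])
  then show ?thesis
    by (intro matrix7_eq_columns) (simp_all add: fixed std_proj_e7 flip: matrix_vector_mul_assoc)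
qed

lemma MS'_eq_conj_std_proj:
  assumes p: "p \<in> MS'"
    and i: "i \<in> range ((*v) p)" and j: "j \<in> range ((*v) p)"
    and orth: "i \<bullet> i = 1" "j \<bullet> j = 1" "i \<bullet> j = 0"
    and l: "\<forall>x\<in>range ((*v) p). l \<bullet> x = 0" "l \<bullet> l = 1"
  shows "matrix_conj (frame_matrix (g2_frame i j l)) std_proj = p"
    and "cross7_automorphism (frame_matrix (g2_frame i j l))"
proof -
  have G: "p \<in> Gr3" using p by (simp add: MS'_def)
  have k: "p *v cross7 i j = cross7 i j" by (rule MS'_cross7_closed[OF p i j])
  have "i \<bullet> l = 0" "j \<bullet> l = 0" "cross7 i j \<bullet> l = 0"
    using l(1) i j k by (metis inner_commute rangeI)+
  note frame = g2_frame_orthonormal_table[OF orth(1,2) l(2) orth(3) this]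
  let ?Q = "frame_matrix (g2_frame i j l)"
  have Q: "orthogonal_matrix ?Q"
    by (rule orthogonal_frame_matrix[OF frame(1)])
  show "cross7_automorphism ?Q"
    by unfold_locales (fact Q, rule frame_matrix_cross7[OF frame(2)])
  have "p ** ?Q = ?Q ** std_proj"
    by (rule Gr3_mult_frame_matrix[OF G frame(1)]) (use i j k Gr3_idem[OF G] in auto)
  then have "matrix_conj ?Q std_proj = (p ** ?Q) ** transpose ?Q"
    by (simp add: matrix_conj_def)
  also have "\<dots> = p"
    using Q by (simp add: orthogonal_matrix_def flip: matrix_mul_assoc)
  finally show "matrix_conj ?Q std_proj = p" .
qed

lemma g2_frame_std_normal:
  "frame_matrix (g2_frame i j l) *v std_normal a =
     a$0 *\<^sub>R l + a$1 *\<^sub>R cross7 i l + a$2 *\<^sub>R cross7 j l + a$3 *\<^sub>R cross7 (cross7 i j) l"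
  using cross7_anticomm[of l "cross7 i j"]
  by (simp add: std_normal_def matrix_vector_right_distrib matrix_vector_mult_diff_distrib
      matrix_vector_mult_scaleR)

theorem mainTheorem16:
  fixes p :: "real^7^7" and i j k l :: "real^7"
  assumes hp: "p \<in> MS'"
    and hi: "i \<in> range ((*v) p)" and hj: "j \<in> range ((*v) p)"
    and horth: "i \<bullet> i = 1" "j \<bullet> j = 1" "i \<bullet> j = 0"
    and hk: "k = cross7 i j"
    and hl: "\<forall>x\<in>range ((*v) p). l \<bullet> x = 0" and hl1: "l \<bullet> l = 1"
  shows "(\<forall>a0 a1 a2 a3 b0 b1 b2 b3 :: real.
            \<exists>!d. d \<in> TMS' p \<and>
              d *v i = a0 *\<^sub>R l + a1 *\<^sub>R cross7 i l + a2 *\<^sub>R cross7 j l + a3 *\<^sub>R cross7 k l \<and>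
              d *v j = b0 *\<^sub>R l + b1 *\<^sub>R cross7 i l + b2 *\<^sub>R cross7 j l + b3 *\<^sub>R cross7 k l)
         \<and> subspace (TMS' p) \<and> dim (TMS' p) = 8
         \<and> lie_triple_subsystem (TMS' p) (TGr3 p)"
proof -
  let ?Q = "frame_matrix (g2_frame i j l)"
  note conj = MS'_eq_conj_std_proj[OF hp hi hj horth hl hl1]
  interpret cross7_automorphism ?Q by (fact conj(2))
  have "\<exists>!d. d \<in> TMS' p \<and>
      d *v i = a0 *\<^sub>R l + a1 *\<^sub>R cross7 i l + a2 *\<^sub>R cross7 j l + a3 *\<^sub>R cross7 k l \<and>
      d *v j = b0 *\<^sub>R l + b1 *\<^sub>R cross7 i l + b2 *\<^sub>R cross7 j l + b3 *\<^sub>R cross7 k l"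
    for a0 a1 a2 a3 b0 b1 b2 b3 :: real
    using ex1_TMS'_conj_std_proj[of "\<chi> q. if q = 0 then a0 else if q = 1 then a1 else if q = 2 then a2 else a3"
        "\<chi> q. if q = 0 then b0 else if q = 1 then b1 else if q = 2 then b2 else b3"]
    by (simp add: conj(1) g2_frame_std_normal hk)
  then show ?thesis
    using subspace_TMS'_conj_std_proj dim_TMS'_conj_std_proj lie_triple_subsystem_TMS'_conj_std_proj
    by (simp add: conj(1))
qed

end
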